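(* Let $k$ be a positive integer with \[k\notin\{2,3,6,7,8,9,12,15,16,17,18,19,31,32,33,34\}.\] Then there exists a permutation $\pi$ (of some rank $n\ge 1$) such that $\mathbf{1}\cdot\pi = k$.
   Context: A permutation of rank $n$ is a bijection $\pi:\{1,\dots,n\}\to\{1,\dots,n\}$, written $\pi_1\pi_2\cdots\pi_n$ with $\pi_i=\pi(i)$. The cosine of $\pi$ is $\mathbf{1}\cdot\pi=\sum_{i=1}^n i\,\pi(i)$, i.e. the dot product of $\pi$ (viewed as a vector) with the identity permutation $\mathbf{1}=12\cdots n$ of the same rank. *)

theory Defs
  imports "HOL-Combinatorics.Permutations"
begin

(* A permutation of rank n is a function p with "p permutes {1..n}", that is, a bijection of
   {1..n} extended by the identity outside {1..n}; perm_cosine uses only its values on {1..n}. *)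
definition perm_cosine :: "nat \<Rightarrow> (nat \<Rightarrow> nat) \<Rightarrow> nat" where
  "perm_cosine n p = (\<Sum>i=1..n. i * p i)"

end

theory Submission
  imports Defs
begin

text \<open>
  The cosines of rank \<open>n \<ge> 4\<close> fill the whole interval from \<open>n(n+1)(n+2)/6\<close> to
  \<open>n(n+1)(2n+1)/6\<close>. Fixing the last point \<open>N = n + 1\<close> adds \<open>N\<^sup>2\<close>, so by induction rank \<open>N\<close>
  attains everything from \<open>N\<^sup>2 + n(n+1)(n+2)/6\<close> upwards, which is at least the upper half of the
  interval once \<open>N \<ge> 5\<close>; composing with the reversal reflects the interval and gives the lower
  half. From rank 5 on, consecutive intervals leave no gap.
\<close>

definition is_cosine :: "nat \<Rightarrow> nat \<Rightarrow> bool" where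
  "is_cosine n k \<longleftrightarrow> (\<exists>p. p permutes {1..n} \<and> perm_cosine n p = k)"

lemma is_cosineI: "p permutes {1..n} \<Longrightarrow> perm_cosine n p = k \<Longrightarrow> is_cosine n k"
  by (auto simp: is_cosine_def)

lemma is_cosine_Suc:
  assumes "is_cosine n k"
  shows "is_cosine (Suc n) (k + (Suc n)\<^sup>2)"
proof -
  obtain p where p: "p permutes {1..n}" "perm_cosine n p = k"
    using assms by (auto simp: is_cosine_def)
  have "p (Suc n) = Suc n"
    using p(1) by (rule permutes_not_in) simp
  then have "perm_cosine (Suc n) p = k + (Suc n)\<^sup>2"
    using p(2) by (simp add: perm_cosine_def power2_eq_square)
  moreover have "p permutes {1..Suc n}"
    using p(1) by (rule permutes_subset) simp
  ultimately show ?thesis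
    by (blast intro: is_cosineI)
qed

lemma double_sum_upto: "2 * (\<Sum>i=1..n. i) = n * (n + 1)" for n :: nat
  by (induction n) auto

text \<open>Composing with the reversal replaces each value \<open>p i\<close> by
  \<open>n + 1 - p i\<close>, so the two cosines add up to \<open>n + 1\<close> times
  \<open>1 + ... + n\<close>. The doubled hypothesis avoids a division.\<close>

lemma is_cosine_reverse:
  assumes "is_cosine n k" and "2 * (k + l) = n * (n + 1)\<^sup>2"
  shows "is_cosine n l"
proof -
  obtain p where p: "p permutes {1..n}" "perm_cosine n p = k"
    using assms(1) by (auto simp: is_cosine_def)
  define r where "r i = (if i \<in> {1..n} then n + 1 - i else i)" for i
  have "bij_betw r {1..n} {1..n}"
    \<comment> \<open>\<open>r\<close> is an involution, hence its own inverse.\<close>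
    by (rule bij_betwI[where g = r]) (auto simp: r_def)
  then have r: "r permutes {1..n}"
    by (rule bij_imp_permutes) (auto simp: r_def)
  have "perm_cosine n (r \<circ> p) + perm_cosine n p = (\<Sum>i=1..n. i * (n + 1))"
    unfolding perm_cosine_def sum.distrib[symmetric]
  proof (rule sum.cong[OF refl])
    fix i assume "i \<in> {1..n}"
    then have "p i \<in> {1..n}"
      using p(1) by (simp only: permutes_in_image)
    then have "(r \<circ> p) i + p i = n + 1"
      by (auto simp: r_def)
    then show "i * (r \<circ> p) i + i * p i = i * (n + 1)"
      by (metis distrib_left)
  qed
  then have "2 * (perm_cosine n (r \<circ> p) + k) = (2 * (\<Sum>i=1..n. i)) * (n + 1)"
    using p(2) by (simp only: sum_distrib_right mult.assoc)
  also have "\<dots> = 2 * (k + l)"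
    unfolding double_sum_upto assms(2) by (simp add: power2_eq_square algebra_simps)
  finally have "perm_cosine n (r \<circ> p) = l"
    by simp
  with permutes_compose[OF p(1) r] show ?thesis
    by (rule is_cosineI)
qed

lemma is_cosine_1: "is_cosine 1 1"
  by (rule is_cosineI[OF permutes_id]) (simp add: perm_cosine_def)

lemma is_cosine_2: "is_cosine 2 5" "is_cosine 2 4"
proof -
  show "is_cosine 2 5"
    using is_cosine_Suc[OF is_cosine_1] by (simp add: numeral_eq_Suc)
  then show "is_cosine 2 4"
    by (rule is_cosine_reverse) simp
qed

text \<open>Fixing the point 3 adds 9 to the cosines 4 and 5; reflection in rank 3 pairs values with
  sum 24.\<close>

lemma is_cosine_3:
  assumes "k \<in> {10, 11, 13, 14}"
  shows "is_cosine 3 k"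
proof -
  have *: "is_cosine 3 13" "is_cosine 3 14"
    using is_cosine_2[THEN is_cosine_Suc] by (simp_all add: numeral_eq_Suc)
  have "is_cosine 3 11" "is_cosine 3 10"
    by (rule is_cosine_reverse[OF *(1)], simp) (rule is_cosine_reverse[OF *(2)], simp)
  with * assms show ?thesis
    by auto
qed

text \<open>
  The values 25 and 28 are not attained with the last point fixed, because rank 3 omits 9 and 12;
  they need witnesses of their own.
\<close>

lemma is_cosine_4:
  assumes "20 \<le> k" "k \<le> 30"
  shows "is_cosine 4 k"
proof -
  have "is_cosine 4 (k + 16)" if "k \<in> {10, 11, 13, 14}" for k
    using is_cosine_Suc[OF is_cosine_3[OF that]] by (simp add: numeral_eq_Suc)
  from this[of 10] this[of 11] this[of 13] this[of 14]
  have a: "is_cosine 4 26" "is_cosine 4 27" "is_cosine 4 29" "is_cosine 4 30"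
    by simp_all
  have b: "is_cosine 4 28"
    by (rule is_cosineI[of "transpose 1 2 \<circ> transpose 3 4"])
      (auto intro!: permutes_compose permutes_swap_id
        simp: perm_cosine_def numeral_eq_Suc transpose_def)
  \<comment> \<open>In one-line notation this witness is 2413, the previous one 2143.\<close>
  have c: "is_cosine 4 25"
    by (rule is_cosineI[of "transpose 3 4 \<circ> transpose 1 2 \<circ> transpose 2 3"])
      (auto intro!: permutes_compose permutes_swap_id
        simp: perm_cosine_def numeral_eq_Suc transpose_def)
  have upper: "is_cosine 4 l" if "25 \<le> l" "l \<le> 30" for l
  proof -
    have "l \<in> {25, 26, 27, 28, 29, 30}"
      using that by auto
    with a b c show ?thesis
      by auto
  qed
  show ?thesis
  proof (cases "25 \<le> k")
    case False
    \<comment> \<open>In rank 4 reflected cosines sum to 4 * 25 / 2 = 50.\<close>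
    have "is_cosine 4 (50 - k)"
      by (rule upper) (use False assms in auto)
    then show ?thesis
      by (rule is_cosine_reverse) (use False in auto)
  qed (use upper assms in auto)
qed

text \<open>The bounds, scaled by 6, are the cosines of the reversal and the identity. The induction
  starts at 4 because rank 3 misses 12.\<close>

lemma is_cosine_interval:
  assumes "4 \<le> n" "n * (n + 1) * (n + 2) \<le> 6 * k" "6 * k \<le> n * (n + 1) * (2 * n + 1)"
  shows "is_cosine n k"
  using assms
proof (induction n arbitrary: k rule: dec_induct)
  case base
  then show ?case
    by (intro is_cosine_4) auto
next
  case (step n)
  obtain m where n: "n = m + 4"
    using \<open>4 \<le> n\<close> by (metis le_add_diff_inverse2)
  have upper: "is_cosine (Suc n) l"
    if "6 * (Suc n)\<^sup>2 + n * (n + 1) * (n + 2) \<le> 6 * l"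
      and "6 * l \<le> Suc n * (Suc n + 1) * (2 * Suc n + 1)" for l
  proof -
    from that(1) have "(Suc n)\<^sup>2 \<le> l"
      by linarith
    then obtain j where l: "l = j + (Suc n)\<^sup>2"
      by (metis le_add_diff_inverse2)
    \<comment> \<open>The upper ends of ranks \<open>n\<close> and \<open>Suc n\<close> differ by
      exactly \<open>(Suc n)\<^sup>2\<close>, so \<open>j\<close> lies in the interval of rank
      \<open>n\<close>.\<close>
    have "is_cosine n j"
      by (rule step.IH)
        (use that in \<open>simp_all add: l power2_eq_square algebra_simps\<close>)
    then show ?thesis
      unfolding l by (rule is_cosine_Suc)
  qed
  show ?case
  proof (cases "6 * (Suc n)\<^sup>2 + n * (n + 1) * (n + 2) \<le> 6 * k")
    case True
    then show ?thesis
      using step.prems by (intro upper) auto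
  next
    case False
    have "even (Suc n * (Suc n + 1)\<^sup>2)"
      by simp
    then obtain s where s: "Suc n * (Suc n + 1)\<^sup>2 = 2 * s"
      by (elim dvdE)
    have "k \<le> s"
      using False s by (simp add: n power2_eq_square algebra_simps)
    then obtain l where l: "s = k + l"
      using le_Suc_ex by blast
    \<comment> \<open>Twice the threshold of \<open>upper\<close> is at most \<open>6 * s\<close>:
      after cancelling \<open>n + 1\<close> this says \<open>4 * n \<le> n\<^sup>2\<close>, which is
      where \<open>4 \<le> n\<close> enters.\<close>
    have "is_cosine (Suc n) l"
      by (rule upper)
        (use False s step.prems in \<open>simp_all add: l n power2_eq_square algebra_simps\<close>)
    then show ?thesis
      by (rule is_cosine_reverse) (use s l in simp)
  qed
qed

text \<open>Rank 5 covers 35 to 55 and rank 6 starts at 56; later intervals overlap.\<close>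

lemma is_cosine_ge_35:
  assumes "5 \<le> n" "35 \<le> k" "6 * k \<le> n * (n + 1) * (2 * n + 1)"
  shows "\<exists>m\<ge>1. is_cosine m k"
  using assms
proof (induction n rule: dec_induct)
  case base
  then have "is_cosine 5 k"
    by (intro is_cosine_interval) auto
  then show ?case
    by (intro exI[of _ 5]) simp
next
  case (step n)
  show ?case
  proof (cases "6 * k \<le> n * (n + 1) * (2 * n + 1)")
    case True
    then show ?thesis
      using step by blast
  next
    case False
    obtain m where n: "n = m + 5"
      using \<open>5 \<le> n\<close> by (metis le_add_diff_inverse2)
    \<comment> \<open>Divisibility sharpens the strict bound by a full 6, which is needed at
      \<open>n = 5\<close>, where 56 directly follows 55.\<close>
    have "6 dvd n * (n + 1) * (2 * n + 1)"
      by (rule dvdI[of _ _ "\<Sum>i=1..n. i\<^sup>2"]) (induction n, auto simp: power2_eq_square algebra_simps)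
    with False have "n * (n + 1) * (2 * n + 1) + 6 \<le> 6 * k"
      by (elim dvdE) simp
    then have "is_cosine (Suc n) k"
      using step.prems
      by (intro is_cosine_interval) (simp_all add: n algebra_simps)
    then show ?thesis
      by (intro exI[of _ "Suc n"]) simp
  qed
qed

theorem theorem2p2:
  fixes k :: nat
  assumes "k > 0"
    and "k \<notin> {2, 3, 6, 7, 8, 9, 12, 15, 16, 17, 18, 19, 31, 32, 33, 34}"
  shows "\<exists>n p. n \<ge> 1 \<and> p permutes {1..n} \<and> perm_cosine n p = k"
proof -
  \<comment> \<open>The cases correspond to ranks 1, 2, 3, 4 and at least 5.\<close>
  consider "k = 1" | "k \<in> {4, 5}" | "k \<in> {10, 11, 13, 14}" | "20 \<le> k" "k \<le> 30" | "35 \<le> k"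
  proof -
    have "k \<in> {1, 4, 5, 10, 11, 13, 14}" if "k < 20"
    proof -
      have "k \<in> {..<20}"
        using that by simp
      then show ?thesis
        using assms by (auto simp: lessThan_Suc numeral_eq_Suc)
    qed
    moreover have "k \<le> 30 \<or> 35 \<le> k"
      using assms(2) by (simp, presburger)
    ultimately show ?thesis
      using that by (cases "k < 20") auto
  qed
  then have "\<exists>n\<ge>1. is_cosine n k"
  proof cases
    case 1
    then show ?thesis
      using is_cosine_1 by blast
  next
    case 2
    then show ?thesis
      using is_cosine_2 by (intro exI[of _ 2]) auto
  next
    case 3
    then show ?thesis
      using is_cosine_3 by (intro exI[of _ 3]) auto
  next
    case 4
    then show ?thesis
      using is_cosine_4 by (intro exI[of _ 4]) auto
  next
    case 5
    \<comment> \<open>Any rank bound whose identity has cosine at least \<open>k\<close> will do;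
      \<open>k\<close> itself is large enough.\<close>
    have "k * 6 * 1 \<le> k * (k + 1) * (2 * k + 1)"
      by (intro mult_le_mono) (use 5 in auto)
    with 5 show ?thesis
      by (intro is_cosine_ge_35[of k]) auto
  qed
  then show ?thesis
    unfolding is_cosine_def by blast
qed

end
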